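(* Let $\alpha \ge 1$. Suppose that for every resource unit $r\in\mathcal{R}$ the marginal cost function used by \textsc{OnSocMax} has the form $$\hat\phi_r(\omega)=\begin{cases}\iota, & \omega\in[0,\hat\varpi_r),\\ \hat\varphi_r(\omega), & \omega\in[\hat\varpi_r,C_r],\\ +\infty, & \omega\in(C_r,+\infty),\end{cases}$$ where $\hat\varpi_r$ is a resource utilization threshold and $\hat\varphi_r$ is a non-decreasing function satisfying $$\hat\varphi_r(\omega)\,C_r\le \alpha\int_0^{\omega}\hat\phi_r(u)\,du-\iota\,\omega\quad\text{for all }\omega\in[\hat\varpi_r,C_r],\qquad \hat\varphi_r(\hat\varpi_r)=\iota,\qquad \hat\varphi_r(C_r)\ge\upsilon .$$ Then \textsc{OnSocMax} run with the marginal cost functions $\{\hat\phi_r\}_{r\in\mathcal{R}}$ is $\alpha$-competitive.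
   Context: Model. $\mathcal{K}$ is a finite set of nodes, $\mathcal{T}$ a finite set of time slots of length $\tau$, and $\mathcal{R}=\mathcal{K}\times\mathcal{T}$ is the set of resource units; unit $r$ has capacity $C_r>0$. $\mathcal{N}=\{1,2,\dots,|\mathcal{N}|\}$ is a finite set of jobs, indexed in order of arrival. Job $n$ has arrival time $a_n$, deadline $d_n$, target workload $\varrho_n$, a set $\mathcal{K}_n\subseteq\mathcal{K}$ of allowed nodes, available units $\mathcal{R}_n=\{(k,t)\in\mathcal{R}: \lceil a_n/\tau\rceil\le t\le\lfloor d_n/\tau\rfloor,\ k\in\mathcal{K}_n\}$, and per-unit limits $\overline\chi_{nr}$ ($r\in\mathcal{R}_n$). Its utility is $f_n(x_n)=\sum_{r\in\mathcal{R}_n}f_{nr}(x_{nr})$, where each $f_{nr}$ on $[0,\overline\chi_{nr}]$ satisfies $f_{nr}(0)=0$ and is non-decreasing, concave and continuously differentiable. The cluster utility terms are $g_{nr}(x)=\beta_{nr}\,x/C_r$ with weights $\beta_{nr}$. Problem $\mathcal{P}_1$ (social welfare maximization): maximize $\sum_{n}\sum_{r\in\mathcal{R}_n}\big(f_{nr}(x_{nr})+g_{nr}(x_{nr})\big)$ subject to $\sum_{r\in\mathcal{R}_n}x_{nr}\le\varrho_n$ for all $n$; $x_{nr}=0$ for $r\in\mathcal{R}\setminus\mathcal{R}_n$; $\sum_{n}x_{nr}\le C_r$ for all $r\in\mathcal{R}$; $0\le x_{nr}\le\overline\chi_{nr}$ for $r\in\mathcal{R}_n$. Constants: $\iota=\min_{n\in\mathcal{N}}\min_{r\in\mathcal{R}_n}\big(\partial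 f_n/\partial x_{nr}+\beta_{nr}/C_r\big)$ and $\upsilon=\max_{n\in\mathcal{N}}\max_{r\in\mathcal{R}_n}\big(\partial f_n/\partial x_{nr}+\beta_{nr}/C_r\big)$, the min and max being also over $x_{nr}\in[0,\overline\chi_{nr}]$. These constants are regarded as known in advance to the online algorithm. Online setting: the data $\{\varrho_n,\mathcal{R}_n,(\overline\chi_{nr})_{r\in\mathcal{R}_n},f_n\}$ of job $n$ is revealed only when job $n$ arrives, at which time $x_n=(x_{nr})_{r\in\mathcal{R}_n}$ must be fixed irrevocably. Algorithm \textsc{OnSocMax} (with marginal cost functions $\phi_r$, non-decreasing on $[0,C_r]$ and $+\infty$ on $(C_r,\infty)$): set $\hat\omega_r^{(1)}=0$ for all $r$. When job $n$ arrives, let $\hat x_n$ be an optimal solution of $$\mathcal{P}_3:\ \max_{x_n}\ f_n(x_n)-\sum_{r\in\mathcal{R}_n}\int_{\hat\omega_r^{(n)}}^{\hat\omega_r^{(n)}+x_{nr}}\phi_r(u)\,du+\sum_{r\in\mathcal{R}_n}g_{nr}(x_{nr})$$ subject to $\sum_{r\in\mathcal{R}_n}x_{nr}\le\varrho_n$, $x_{nr}=0$ for $r\notin\mathcal{R}_n$, $0\le x_{nr}\le\overline\chi_{nr}$ for $r\in\mathcal{R}_n$; then set $\hat\omega_r^{(n+1)}=\hat\omega_r^{(n)}+\hat x_{nr}$. The output is $\{\hat x_n\}_{n\in\mathcal{N}}$. Competitive ratio: for an arrival instance $\mathcal{A}$ of the jobs (with the given constants $\iota,\upsilon$), let $\Theta^*_{\mathcal{P}_1}(\mathcal{A})$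 be the optimal value of $\mathcal{P}_1$ and $\Theta_{on}(\mathcal{A})$ the objective value of $\mathcal{P}_1$ attained by the online algorithm. The competitive ratio is $\max_{\mathcal{A}}\Theta^*_{\mathcal{P}_1}(\mathcal{A})/\Theta_{on}(\mathcal{A})$, and the algorithm is $\alpha$-competitive if this ratio is at most $\alpha$.
   Formalization: The statement fails if OnSocMax may pick any optimal solution of P3 (it may idle when marginal value equals ι); here it must pick one not dominated componentwise by another optimum. Weights β are taken nonnegative (so ι ≥ 0), limits χ positive and workloads nonnegative. *)

theory Defs
  imports "HOL-Analysis.Analysis"
begin

type_synonym 'k runit = "'k \<times> int"  \<comment> \<open>a resource unit: node and time slot\<close>

record 'k cluster =
  cl_nodes :: "'k set"
  cl_slots :: "int set"
  slot_len :: real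
  capacity :: "'k runit \<Rightarrow> real"

definition units :: "'k cluster \<Rightarrow> 'k runit set" where
  "units S = cl_nodes S \<times> cl_slots S"

definition wf_cluster :: "'k cluster \<Rightarrow> bool" where
  "wf_cluster S \<longleftrightarrow> finite (cl_nodes S) \<and> finite (cl_slots S) \<and> slot_len S > 0 \<and>
     (\<forall>r\<in>units S. capacity S r > 0)"

record 'k arrivals =
  num_jobs :: nat
  arrival :: "nat \<Rightarrow> real"
  deadline :: "nat \<Rightarrow> real"
  workload :: "nat \<Rightarrow> real"
  allowed :: "nat \<Rightarrow> 'k set"
  limit :: "nat \<Rightarrow> 'k runit \<Rightarrow> real"
  utility :: "nat \<Rightarrow> 'k runit \<Rightarrow> real \<Rightarrow> real"
  weight :: "nat \<Rightarrow> 'k runit \<Rightarrow> real"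

definition jobs :: "'k arrivals \<Rightarrow> nat set" where
  "jobs A = {1..num_jobs A}"

definition avail :: "'k cluster \<Rightarrow> 'k arrivals \<Rightarrow> nat \<Rightarrow> 'k runit set" where
  "avail S A n = {(k, t) \<in> units S.
     \<lceil>arrival A n / slot_len S\<rceil> \<le> t \<and> t \<le> \<lfloor>deadline A n / slot_len S\<rfloor> \<and> k \<in> allowed A n}"

definition cont_diff_on :: "real set \<Rightarrow> (real \<Rightarrow> real) \<Rightarrow> bool" where
  "cont_diff_on I f \<longleftrightarrow>
     (\<exists>f'. continuous_on I f' \<and> (\<forall>x\<in>I. (f has_real_derivative f' x) (at x within I)))"

text \<open>
  The limits are positive so that the derivative within \<open>{0..limit A n r}\<close> is unique
  (at a point of a degenerate interval every number is a derivative).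
  A nonnegative workload makes the null allocation feasible; with nonnegative weights all marginal
  values, and the welfare of a feasible allocation, are nonnegative, so that ratios of welfare make sense.
\<close>
definition wf_arrivals :: "'k cluster \<Rightarrow> 'k arrivals \<Rightarrow> bool" where
  "wf_arrivals S A \<longleftrightarrow>
     (\<forall>m\<in>jobs A. \<forall>n\<in>jobs A. m \<le> n \<longrightarrow> arrival A m \<le> arrival A n) \<and>
     (\<forall>n\<in>jobs A. workload A n \<ge> 0 \<and> allowed A n \<subseteq> cl_nodes S \<and>
       (\<forall>r\<in>avail S A n.
          limit A n r > 0 \<and> weight A n r \<ge> 0 \<and>
          utility A n r 0 = 0 \<and>
          mono_on {0..limit A n r} (utility A n r) \<and>
          concave_on {0..limit A n r} (utility A n r) \<and>
          cont_diff_on {0..limit A n r} (utility A n r)))"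

text \<open>All values of \<open>\<partial>f\<^sub>n/\<partial>x\<^sub>n\<^sub>r + \<beta>\<^sub>n\<^sub>r/C\<^sub>r\<close>; derivatives at endpoints are one-sided.\<close>
definition marginal_values :: "'k cluster \<Rightarrow> 'k arrivals \<Rightarrow> real set" where
  "marginal_values S A = {D + weight A n r / capacity S r | D n r x.
     n \<in> jobs A \<and> r \<in> avail S A n \<and> x \<in> {0..limit A n r} \<and>
     (utility A n r has_real_derivative D) (at x within {0..limit A n r})}"

definition is_minimum :: "real set \<Rightarrow> real \<Rightarrow> bool" where
  "is_minimum M v \<longleftrightarrow> v \<in> M \<and> (\<forall>w\<in>M. v \<le> w)"

definition is_maximum :: "real set \<Rightarrow> real \<Rightarrow> bool" where
  "is_maximum M v \<longleftrightarrow> v \<in> M \<and> (\<forall>w\<in>M. w \<le> v)"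

definition instances :: "'k cluster \<Rightarrow> real \<Rightarrow> real \<Rightarrow> 'k arrivals set" where
  "instances S \<iota> \<upsilon> = {A. wf_arrivals S A \<and>
     is_minimum (marginal_values S A) \<iota> \<and> is_maximum (marginal_values S A) \<upsilon>}"

definition job_utility :: "'k cluster \<Rightarrow> 'k arrivals \<Rightarrow> nat \<Rightarrow> ('k runit \<Rightarrow> real) \<Rightarrow> real" where
  "job_utility S A n x = (\<Sum>r\<in>avail S A n. utility A n r (x r))"

definition cluster_utility :: "'k cluster \<Rightarrow> 'k arrivals \<Rightarrow> nat \<Rightarrow> ('k runit \<Rightarrow> real) \<Rightarrow> real" where
  "cluster_utility S A n x = (\<Sum>r\<in>avail S A n. weight A n r * x r / capacity S r)"

definition welfare :: "'k cluster \<Rightarrow> 'k arrivals \<Rightarrow> (nat \<Rightarrow> 'k runit \<Rightarrow> real) \<Rightarrow> real" where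
  "welfare S A x = (\<Sum>n\<in>jobs A. job_utility S A n (x n) + cluster_utility S A n (x n))"

definition P1_feasible :: "'k cluster \<Rightarrow> 'k arrivals \<Rightarrow> (nat \<Rightarrow> 'k runit \<Rightarrow> real) \<Rightarrow> bool" where
  "P1_feasible S A x \<longleftrightarrow>
     (\<forall>n\<in>jobs A. (\<Sum>r\<in>avail S A n. x n r) \<le> workload A n) \<and>
     (\<forall>n\<in>jobs A. \<forall>r\<in>units S - avail S A n. x n r = 0) \<and>
     (\<forall>r\<in>units S. (\<Sum>n\<in>jobs A. x n r) \<le> capacity S r) \<and>
     (\<forall>n\<in>jobs A. \<forall>r\<in>avail S A n. 0 \<le> x n r \<and> x n r \<le> limit A n r)"

definition P1_value :: "'k cluster \<Rightarrow> 'k arrivals \<Rightarrow> ereal" where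
  "P1_value S A = (SUP x\<in>{x. P1_feasible S A x}. ereal (welfare S A x))"

text \<open>Lebesgue integral over \<open>{a..b}\<close> of an extended-real function, as positive minus negative part.\<close>
definition ereal_integral :: "real \<Rightarrow> real \<Rightarrow> (real \<Rightarrow> ereal) \<Rightarrow> ereal" where
  "ereal_integral a b \<phi> =
     enn2ereal (\<integral>\<^sup>+u\<in>{a..b}. e2ennreal (\<phi> u) \<partial>lborel) -
     enn2ereal (\<integral>\<^sup>+u\<in>{a..b}. e2ennreal (- \<phi> u) \<partial>lborel)"

definition P3_feasible :: "'k cluster \<Rightarrow> 'k arrivals \<Rightarrow> nat \<Rightarrow> ('k runit \<Rightarrow> real) \<Rightarrow> bool" where
  "P3_feasible S A n x \<longleftrightarrow>
     (\<Sum>r\<in>avail S A n. x r) \<le> workload A n \<and>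
     (\<forall>r. r \<notin> avail S A n \<longrightarrow> x r = 0) \<and>
     (\<forall>r\<in>avail S A n. 0 \<le> x r \<and> x r \<le> limit A n r)"

definition P3_objective :: "'k cluster \<Rightarrow> 'k arrivals \<Rightarrow> ('k runit \<Rightarrow> real \<Rightarrow> ereal) \<Rightarrow>
    ('k runit \<Rightarrow> real) \<Rightarrow> nat \<Rightarrow> ('k runit \<Rightarrow> real) \<Rightarrow> ereal" where
  "P3_objective S A \<phi> \<omega> n x =
     ereal (job_utility S A n x)
     - (\<Sum>r\<in>avail S A n. ereal_integral (\<omega> r) (\<omega> r + x r) (\<phi> r))
     + ereal (cluster_utility S A n x)"

definition P3_optimal :: "'k cluster \<Rightarrow> 'k arrivals \<Rightarrow> ('k runit \<Rightarrow> real \<Rightarrow> ereal) \<Rightarrow>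
    ('k runit \<Rightarrow> real) \<Rightarrow> nat \<Rightarrow> ('k runit \<Rightarrow> real) \<Rightarrow> bool" where
  "P3_optimal S A \<phi> \<omega> n x \<longleftrightarrow> P3_feasible S A n x \<and>
     (\<forall>y. P3_feasible S A n y \<longrightarrow> P3_objective S A \<phi> \<omega> n y \<le> P3_objective S A \<phi> \<omega> n x)"

text \<open>
  Tie-breaking: the chosen optimal solution is not dominated componentwise by another optimal
  solution, i.e. resources worth exactly their price are not left idle. Without such a rule no
  bound on the competitive ratio holds: if every marginal value of a job equals \<open>\<iota>\<close>, the null
  allocation is optimal as long as the price is \<open>\<iota>\<close>, although the job contributes positive welfare.
\<close>
definition P3_choice :: "'k cluster \<Rightarrow> 'k arrivals \<Rightarrow> ('k runit \<Rightarrow> real \<Rightarrow> ereal) \<Rightarrow>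
    ('k runit \<Rightarrow> real) \<Rightarrow> nat \<Rightarrow> ('k runit \<Rightarrow> real) \<Rightarrow> bool" where
  "P3_choice S A \<phi> \<omega> n x \<longleftrightarrow> P3_optimal S A \<phi> \<omega> n x \<and>
     (\<forall>y. P3_optimal S A \<phi> \<omega> n y \<and> (\<forall>r. x r \<le> y r) \<longrightarrow> y = x)"

definition OnSocMax :: "'k cluster \<Rightarrow> ('k runit \<Rightarrow> real \<Rightarrow> ereal) \<Rightarrow>
    'k arrivals \<Rightarrow> (nat \<Rightarrow> 'k runit \<Rightarrow> real) \<Rightarrow> bool" where
  "OnSocMax S \<phi> A x \<longleftrightarrow>
     (\<exists>\<omega> :: nat \<Rightarrow> 'k runit \<Rightarrow> real.
        (\<forall>r. \<omega> 1 r = 0) \<and>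
        (\<forall>n\<in>jobs A. P3_choice S A \<phi> (\<omega> n) n (x n) \<and>
           (\<forall>r. \<omega> (n + 1) r = \<omega> n r + x n r)))"

text \<open>
  An online algorithm is a relation between arrival instances and its possible outputs.
  Division in \<^typ>\<open>ereal\<close> gives \<open>0 / 0 = 0\<close> and \<open>c / 0 = \<infinity>\<close> for \<open>c > 0\<close>.
\<close>
definition competitive_ratio :: "'k cluster \<Rightarrow> real \<Rightarrow> real \<Rightarrow>
    ('k arrivals \<Rightarrow> (nat \<Rightarrow> 'k runit \<Rightarrow> real) \<Rightarrow> bool) \<Rightarrow> ereal" where
  "competitive_ratio S \<iota> \<upsilon> alg =
     (SUP (A, x)\<in>{(A, x). A \<in> instances S \<iota> \<upsilon> \<and> alg A x}. P1_value S A / ereal (welfare S A x))"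

definition competitive :: "'k cluster \<Rightarrow> real \<Rightarrow> real \<Rightarrow> real \<Rightarrow>
    ('k arrivals \<Rightarrow> (nat \<Rightarrow> 'k runit \<Rightarrow> real) \<Rightarrow> bool) \<Rightarrow> bool" where
  "competitive S \<iota> \<upsilon> \<alpha> alg \<longleftrightarrow> competitive_ratio S \<iota> \<upsilon> alg \<le> ereal \<alpha>"

text \<open>Only evaluated at nonnegative \<open>\<omega>\<close>.\<close>
definition threshold_cost :: "real \<Rightarrow> real \<Rightarrow> real \<Rightarrow> (real \<Rightarrow> real) \<Rightarrow> real \<Rightarrow> ereal" where
  "threshold_cost \<iota> c \<theta> \<psi> \<omega> =
     (if \<omega> < \<theta> then ereal \<iota> else if \<omega> \<le> c then ereal (\<psi> \<omega>) else \<infinity>)"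

end

theory Submission
  imports Defs
begin

text \<open>
  Let \<open>\<omega>\<close> be the final utilization and \<open>\<Phi>\<^sub>r\<close> the cumulative cost of unit \<open>r\<close>. First-order optimality in
  \<open>\<P>\<^sub>3\<close> bounds the welfare of job \<open>n\<close> under a competing allocation \<open>y\<close> by its welfare under the online
  allocation, minus the cost it incurred, plus \<open>y\<^sub>n\<close> priced at the final marginal costs. Summing over
  jobs, it remains to show that \<open>y\<close> at final prices costs at most \<open>\<alpha> (\<Sum>r. \<Phi>\<^sub>r (\<omega> r))\<close>. The capacity
  of a unit above its threshold costs at most \<open>\<alpha> \<Phi>\<^sub>r (\<omega> r) - \<iota> \<omega> r\<close> by hypothesis. Units below the threshold have price
  \<open>\<iota>\<close>; the tie-breaking rule makes each job either exhaust its workload or take its limit on all of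
  them, so the amount that \<open>y\<close> places there is at most the total amount allocated online,
  and the terms \<open>- \<iota> \<omega> r\<close> pay for the part of it above threshold. Since every job
  has nonnegative net value, \<open>(\<alpha> - 1) (\<Sum>r. \<Phi>\<^sub>r (\<omega> r))\<close> is at most \<open>\<alpha> - 1\<close> times the online welfare.
\<close>

subsection \<open>One-sided derivatives on an interval\<close>

text \<open>Difference quotients of a monotone function are nonnegative, and so is their limit;
  \<open>a < b\<close> makes the limit filter nontrivial.\<close>

lemma has_real_derivative_nonneg:
  fixes f :: "real \<Rightarrow> real"
  assumes "mono_on {a..b} f" "a < b" "x \<in> {a..b}"
    and "(f has_real_derivative D) (at x within {a..b})"
  shows "0 \<le> D"
proof (rule tendsto_lowerbound)
  show "((\<lambda>y. (f y - f x) / (y - x)) \<longlongrightarrow> D) (at x within {a..b})"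
    using assms(4) by (simp add: has_field_derivative_iff)
  show "\<forall>\<^sub>F y in at x within {a..b}. 0 \<le> (f y - f x) / (y - x)"
    unfolding eventually_at_filter
  proof (intro always_eventually allI impI)
    fix y assume y: "y \<noteq> x" "y \<in> {a..b}"
    have "x < y \<Longrightarrow> f x \<le> f y" "y < x \<Longrightarrow> f y \<le> f x"
      using mono_onD[OF assms(1)] assms(3) y by auto
    then show "0 \<le> (f y - f x) / (y - x)"
      using y by (cases "x < y") (auto simp: divide_nonneg_pos divide_nonpos_neg)
  qed
  show "at x within {a..b} \<noteq> bot"
    using assms by (simp add: trivial_limit_within)
qed

lemma increment_bounds:
  fixes f f' :: "real \<Rightarrow> real"
  assumes deriv: "\<And>x. x \<in> {0..l} \<Longrightarrow> (f has_real_derivative f' x) (at x within {0..l})"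
    and bounds: "\<And>x. x \<in> {0..l} \<Longrightarrow> p \<le> f' x \<and> f' x \<le> q"
    and ab: "0 \<le> a" "a \<le> b" "b \<le> l"
  shows "p * (b - a) \<le> f b - f a \<and> f b - f a \<le> q * (b - a)"
proof -
  have "\<exists>x\<in>{a..b}. f b - f a = f' x * (b - a)"
  proof (rule mvt_very_simple)
    fix x assume x: "a \<le> x" "x \<le> b"
    have "(f has_real_derivative f' x) (at x within {a..b})"
      using DERIV_subset[OF deriv] x ab by auto
    then show "(f has_derivative (*) (f' x)) (at x within {a..b})"
      by (simp add: has_field_derivative_def)
  qed (use ab in auto)
  then obtain x where x: "x \<in> {a..b}" "f b - f a = f' x * (b - a)" by blast
  have "p \<le> f' x" "f' x \<le> q" using bounds[of x] x(1) ab by auto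
  then show ?thesis unfolding x(2) using ab by (simp add: mult_right_mono)
qed

subsection \<open>Cumulative cost of a resource unit\<close>

text \<open>The real-valued price is frozen at its capacity value, which makes it monotone on the whole line.\<close>
definition price :: "real \<Rightarrow> real \<Rightarrow> real \<Rightarrow> (real \<Rightarrow> real) \<Rightarrow> real \<Rightarrow> real" where
  "price \<iota> c \<theta> \<psi> u = (if min c u < \<theta> then \<iota> else \<psi> (min c u))"

definition cost :: "(real \<Rightarrow> real) \<Rightarrow> real \<Rightarrow> real" where
  "cost h w = integral {0..w} h"

text \<open>A monotone integrand lies between its endpoint values. The first-order argument uses the
  convexity of \<open>cost h\<close> only in this form.\<close>

lemma cost_bounds:
  assumes "mono h" "0 \<le> a" "a \<le> b"
  shows "h a * (b - a) \<le> cost h b - cost h a" "cost h b - cost h a \<le> h b * (b - a)"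
proof -
  have int: "h integrable_on {s..t}" for s t
    using assms(1) by (intro integrable_on_mono_on) (auto simp: mono_def mono_on_def)
  have eq: "cost h b - cost h a = integral {a..b} h"
    using Henstock_Kurzweil_Integration.integral_combine[OF assms(2,3) int]
    by (simp add: cost_def)
  have "integral {a..b} (\<lambda>_. h a) \<le> integral {a..b} h"
    using assms int by (intro integral_le) (auto simp: mono_def)
  then show "h a * (b - a) \<le> cost h b - cost h a"
    using assms eq by (simp add: mult.commute)
  have "integral {a..b} h \<le> integral {a..b} (\<lambda>_. h b)"
    using assms int by (intro integral_le) (auto simp: mono_def)
  then show "cost h b - cost h a \<le> h b * (b - a)"
    using assms eq by (simp add: mult.commute)
qed

locale unit_price =
  fixes \<iota> c \<theta> :: real and \<psi> :: "real \<Rightarrow> real"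
  assumes base_nonneg: "0 \<le> \<iota>"
    and threshold: "0 \<le> \<theta>" "\<theta> \<le> c"
    and mono_above: "mono_on {\<theta>..c} \<psi>"
    and price_threshold: "\<psi> \<theta> = \<iota>"
begin

abbreviation "h \<equiv> price \<iota> c \<theta> \<psi>"

lemma price_mono: "mono h"
proof (rule monoI)
  fix u v :: real assume "u \<le> v"
  then have le: "min c u \<le> min c v" by auto
  have "\<iota> \<le> \<psi> (min c v)" if "\<theta> \<le> min c v"
    using mono_onD[OF mono_above, of \<theta> "min c v"] that threshold price_threshold by simp
  moreover have "\<psi> (min c u) \<le> \<psi> (min c v)" if "\<theta> \<le> min c u"
    by (rule mono_onD[OF mono_above _ _ le]) (use that le in auto)
  ultimately show "h u \<le> h v"
    using le unfolding price_def by (smt (verit))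
qed

lemma price_ge: "\<iota> \<le> h u"
  using mono_onD[OF mono_above, of \<theta> "min c u"] threshold price_threshold
  by (auto simp: price_def)

text \<open>The endpoint \<open>u = \<theta>\<close> is covered because
  \<open>price_threshold\<close> makes both branches agree there; the threshold can thus serve as a
  reference utilization at price \<iota>.\<close>

lemma price_below: "u \<le> \<theta> \<Longrightarrow> h u = \<iota>"
  using threshold price_threshold unfolding price_def min_def by (smt (verit))

lemma price_above: "\<theta> \<le> u \<Longrightarrow> u \<le> c \<Longrightarrow> h u = \<psi> u"
  by (auto simp: price_def)

lemma cost_below: "0 \<le> w \<Longrightarrow> w \<le> \<theta> \<Longrightarrow> cost h w = \<iota> * w"
  using cost_bounds[OF price_mono, of 0 w] threshold by (simp add: price_below) (simp add: cost_def)

section \<open>Agreement with the extended-real integral\<close>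

lemma e2ennreal_threshold_cost:
  "u \<le> c \<Longrightarrow> e2ennreal (threshold_cost \<iota> c \<theta> \<psi> u) = ennreal (h u)"
  by (auto simp: threshold_cost_def price_def ennreal.abs_eq)

lemma negative_part_zero: "e2ennreal (- threshold_cost \<iota> c \<theta> \<psi> u) = 0"
proof (rule e2ennreal_neg)
  have "u \<le> c \<Longrightarrow> threshold_cost \<iota> c \<theta> \<psi> u = ereal (h u)"
    by (auto simp: threshold_cost_def price_def)
  then have "0 \<le> threshold_cost \<iota> c \<theta> \<psi> u"
    using price_ge[of u] base_nonneg by (cases "u \<le> c") (auto simp: threshold_cost_def)
  then show "- threshold_cost \<iota> c \<theta> \<psi> u \<le> 0" by simp
qed

lemma ereal_integral_nonneg: "0 \<le> ereal_integral a b (threshold_cost \<iota> c \<theta> \<psi>)"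
  by (simp add: ereal_integral_def negative_part_zero zero_ennreal.rep_eq)

text \<open>Up to capacity the cost function is finite and equals \<open>h\<close>, whose
  nonnegativity lets the Lebesgue integral be evaluated as the gauge integral behind
  \<open>cost\<close>.\<close>

lemma ereal_integral_eq:
  assumes "0 \<le> a" "a \<le> b" "b \<le> c"
  shows "ereal_integral a b (threshold_cost \<iota> c \<theta> \<psi>) = ereal (cost h b - cost h a)"
proof -
  have int: "h integrable_on {s..t}" for s t
    using price_mono by (intro integrable_on_mono_on) (auto simp: mono_def mono_on_def)
  have eq: "cost h b - cost h a = integral {a..b} h"
    using Henstock_Kurzweil_Integration.integral_combine[OF assms(1,2) int]
    by (simp add: cost_def)
  have nn: "0 \<le> h u" for u using price_ge[of u] base_nonneg by simp
  have [measurable]: "h \<in> borel_measurable borel"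
    by (rule borel_measurable_mono[OF price_mono])
  have "(\<integral>\<^sup>+u\<in>{a..b}. e2ennreal (threshold_cost \<iota> c \<theta> \<psi> u) \<partial>lborel) =
      (\<integral>\<^sup>+u. ennreal (h u * indicator {a..b} u) \<partial>lborel)"
    using assms by (intro nn_integral_cong) (auto simp: indicator_def e2ennreal_threshold_cost)
  also have "\<dots> = ennreal (integral {a..b} h)"
  proof (rule nn_integral_has_integral_lborel)
    show "((\<lambda>u. h u * indicator {a..b} u) has_integral integral {a..b} h) UNIV"
    proof -
      have "(\<lambda>u. h u * indicator {a..b} u) = (\<lambda>u. if u \<in> {a..b} then h u else 0)"
        by (auto simp: indicator_def)
      then show ?thesis
        using integrable_integral[OF int, of a b] by (simp only: has_integral_restrict_UNIV)
    qed
  qed (use nn in auto)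
  also have "integral {a..b} h = cost h b - cost h a" by (simp add: eq)
  finally have "ereal_integral a b (threshold_cost \<iota> c \<theta> \<psi>) = enn2ereal (ennreal (cost h b - cost h a))"
    by (simp add: ereal_integral_def negative_part_zero zero_ennreal.rep_eq)
  moreover have "0 \<le> cost h b - cost h a"
    using cost_bounds(1)[OF price_mono assms(1,2)] nn[of a] assms
    by (meson diff_ge_0_iff_ge mult_nonneg_nonneg order_trans)
  ultimately show ?thesis by (simp add: enn2ereal_ennreal)
qed

text \<open>The part \<open>{c<..b}\<close> of the interval has positive measure and infinite
  marginal cost.\<close>

lemma ereal_integral_infinite:
  assumes "a \<le> c" "c < b"
  shows "ereal_integral a b (threshold_cost \<iota> c \<theta> \<psi>) = \<infinity>"
proof -
  have "(\<integral>\<^sup>+u. \<infinity> * indicator {c<..b} u \<partial>lborel) \<le>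
      (\<integral>\<^sup>+u\<in>{a..b}. e2ennreal (threshold_cost \<iota> c \<theta> \<psi> u) \<partial>lborel)"
    using assms threshold
    by (intro nn_integral_mono) (auto simp: indicator_def threshold_cost_def)
  moreover have "(\<integral>\<^sup>+u. \<infinity> * indicator {c<..b} u \<partial>lborel) = (\<infinity>::ennreal)"
    using assms by (subst nn_integral_cmult_indicator) (auto simp: ennreal_top_mult)
  ultimately show ?thesis
    by (simp add: ereal_integral_def negative_part_zero zero_ennreal.rep_eq top_unique)
qed

end

subsection \<open>First-order optimality of a single job\<close>

text \<open>
  At a saturated unit (\<open>\<omega> + x = c\<close>) no increase is possible; there the bound on the slope of \<open>v\<close>
  by the price at capacity replaces the first-order condition.
\<close>
lemma unit_inequality:
  fixes h v :: "real \<Rightarrow> real"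
  assumes h: "mono h" and \<omega>: "0 \<le> \<omega>" and t: "0 < t" "t \<le> 1"
    and x: "0 \<le> x" and y: "0 \<le> y"
    and conc: "v (x + t * (y - x)) \<ge> (1 - t) * v x + t * v y"
    and slope: "x \<le> y \<Longrightarrow> v y - v x \<le> h c * (y - x)"
    and w: "\<omega> + x \<le> w" and step: "x < y \<Longrightarrow> \<omega> + x < c \<Longrightarrow> \<omega> + x + t * (y - x) \<le> w"
    and sat: "\<omega> + x < c \<or> \<omega> + x = c \<and> w = c"
    and z: "z = (if \<omega> + x = c \<and> x < y then x else x + t * (y - x))"
  shows "v y - v x \<le> (v z - v x - (cost h (\<omega> + z) - cost h (\<omega> + x))) / t
      + h w * y - (cost h (\<omega> + x) - cost h \<omega>)"
proof -
  have \<Delta>: "cost h (\<omega> + x) - cost h \<omega> \<le> h w * x"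
    using cost_bounds(2)[OF h \<omega>, of "\<omega> + x"] x monoD[OF h w]
    by (smt (verit) mult_right_mono)
  show ?thesis
  proof (cases "\<omega> + x = c \<and> x < y")
    case True
    \<comment> \<open>Here \<open>z = x\<close> and \<open>w = c\<close>: the step gains nothing,
      \<open>slope\<close> prices \<open>y - x\<close> at \<open>h c\<close>, and
      \<open>\<Delta>\<close> bounds the cost of \<open>x\<close> at the same price.\<close>
    then show ?thesis using slope \<Delta> sat z by (simp add: algebra_simps)
  next
    case False
    then have z: "z = x + t * (y - x)" using z by (simp only: if_False)
    \<comment> \<open>By concavity the gain on the whole way to \<open>y\<close> is at most
      \<open>1 / t\<close> times the gain of the partial step; only costs remain to be
      compared.\<close>
    have lower: "v y - v x \<le> (v z - v x) / t"
      using conc t unfolding z by (simp add: field_simps)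
    have "(cost h (\<omega> + x) - cost h (\<omega> + z)) / t \<ge> - h w * y + (cost h (\<omega> + x) - cost h \<omega>)"
    proof (cases "x < y")
      case True
      with False sat have "\<omega> + x < c" by auto
      with step True have "\<omega> + z \<le> w" by (simp add: z)
      have "cost h (\<omega> + z) - cost h (\<omega> + x) \<le> h (\<omega> + z) * (z - x)"
        using cost_bounds(2)[OF h, of "\<omega> + x" "\<omega> + z"] \<omega> x True t by (simp add: z)
      also have "\<dots> \<le> h w * (z - x)"
        using monoD[OF h \<open>\<omega> + z \<le> w\<close>] True t by (intro mult_right_mono) (auto simp: z)
      finally have "(cost h (\<omega> + x) - cost h (\<omega> + z)) / t \<ge> h w * (x - y)"
        using t by (simp add: z field_simps)
      then show ?thesis using \<Delta> by (simp add: algebra_simps)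
    next
      case ge: False
      show ?thesis
      proof (cases "x = y")
        case True
        then show ?thesis using \<Delta> by (simp add: z)
      next
        case False
        then have yx: "y < x" using ge by simp
        then have xpos: "0 < x" using y by simp
        have tx: "t * (x - y) \<le> x - y" using t yx by (simp add: mult_left_le_one_le)
        have zx: "z \<le> x" "0 \<le> z" using tx t yx y by (auto simp: z algebra_simps mult_left_mono)
        \<comment> \<open>Moving down refunds \<open>?A\<close>. Prices increase, so the average
          price over the refunded top part is at least the average over all of \<open>x\<close>;
          multiplied out, this is \<open>(x - z) * (?A + ?B) \<le> x * ?A\<close>.\<close>
        let ?A = "cost h (\<omega> + x) - cost h (\<omega> + z)" and ?B = "cost h (\<omega> + z) - cost h \<omega>"
        have A: "h (\<omega> + z) * (x - z) \<le> ?A"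
          using cost_bounds(1)[OF h, of "\<omega> + z" "\<omega> + x"] \<omega> zx by simp
        have B: "?B \<le> h (\<omega> + z) * z"
          using cost_bounds(2)[OF h, of "\<omega>" "\<omega> + z"] \<omega> zx by simp
        have "(x - z) * ?B \<le> (x - z) * (h (\<omega> + z) * z)"
          using B zx by (intro mult_left_mono) auto
        also have "\<dots> \<le> z * ?A"
          using mult_left_mono[OF A, of z] zx by (simp add: mult_ac)
        finally have "(x - z) * (?A + ?B) \<le> x * ?A" by (simp add: algebra_simps)
        then have "t * ((x - y) * (?A + ?B)) \<le> x * ?A" by (simp add: z algebra_simps)
        then have 1: "(x - y) * (?A + ?B) \<le> x * (?A / t)" using t by (simp add: field_simps)
        have "y * (?A + ?B) \<le> x * (h w * y)"
          using mult_left_mono[OF \<Delta>, of y] y by (simp add: mult_ac)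
        then have "x * (?A + ?B - h w * y) \<le> x * (?A / t)"
          using 1 by (simp add: algebra_simps)
        then have "?A + ?B - h w * y \<le> ?A / t" by (rule mult_left_le_imp_le[OF _ xpos])
        then show ?thesis by (simp add: algebra_simps)
      qed
    qed
    then show ?thesis using lower by (simp add: diff_divide_distrib)
  qed
qed

text \<open>
  Optimality is tested against small steps from \<open>x\<close> towards \<open>y\<close>, so the prices \<open>h r (w r)\<close> may be
  taken at any utilization \<open>w r\<close> strictly beyond that of \<open>x\<close>, or at capacity.
\<close>
lemma job_inequality:
  fixes h v :: "'r \<Rightarrow> real \<Rightarrow> real"
  assumes fin: "finite R"
    and h: "\<And>r. r \<in> R \<Longrightarrow> mono (h r)"
    and \<omega>: "\<And>r. r \<in> R \<Longrightarrow> 0 \<le> \<omega> r"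
    and x: "\<And>r. r \<in> R \<Longrightarrow> 0 \<le> x r \<and> x r \<le> l r" "sum x R \<le> b"
    and y: "\<And>r. r \<in> R \<Longrightarrow> 0 \<le> y r \<and> y r \<le> l r" "sum y R \<le> b"
    and conc: "\<And>r t. r \<in> R \<Longrightarrow> 0 \<le> t \<Longrightarrow> t \<le> 1 \<Longrightarrow>
      v r (x r + t * (y r - x r)) \<ge> (1 - t) * v r (x r) + t * v r (y r)"
    and slope: "\<And>r. r \<in> R \<Longrightarrow> x r \<le> y r \<Longrightarrow> v r (y r) - v r (x r) \<le> h r (c r) * (y r - x r)"
    and w: "\<And>r. r \<in> R \<Longrightarrow> \<omega> r + x r \<le> w r \<and> w r \<le> c r \<and> (\<omega> r + x r = w r \<longrightarrow> w r = c r)"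
    and opt: "\<And>z. (\<And>r. r \<in> R \<Longrightarrow> 0 \<le> z r \<and> z r \<le> l r \<and> \<omega> r + z r \<le> c r) \<Longrightarrow> sum z R \<le> b \<Longrightarrow>
      (\<Sum>r\<in>R. v r (z r) - (cost (h r) (\<omega> r + z r) - cost (h r) (\<omega> r))) \<le>
      (\<Sum>r\<in>R. v r (x r) - (cost (h r) (\<omega> r + x r) - cost (h r) (\<omega> r)))"
  shows "(\<Sum>r\<in>R. v r (y r)) \<le>
    (\<Sum>r\<in>R. v r (x r) - (cost (h r) (\<omega> r + x r) - cost (h r) (\<omega> r))) + (\<Sum>r\<in>R. h r (w r) * y r)"
proof -
  \<comment> \<open>Finiteness of \<open>R\<close> yields one step size that keeps every unsaturated
    unit within its reference utilization.\<close>
  have "\<forall>\<^sub>F t in at_right 0. \<forall>r\<in>R. \<omega> r + x r < c r \<longrightarrow> \<omega> r + x r + t * (y r - x r) \<le> w r"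
  proof (intro eventually_ball_finite fin ballI)
    fix r assume r: "r \<in> R"
    show "\<forall>\<^sub>F t in at_right 0. \<omega> r + x r < c r \<longrightarrow> \<omega> r + x r + t * (y r - x r) \<le> w r"
    proof (cases "\<omega> r + x r < c r")
      case True
      with w[OF r] have "\<omega> r + x r < w r" by force
      moreover have "((\<lambda>t. \<omega> r + x r + t * (y r - x r)) \<longlongrightarrow> \<omega> r + x r) (at_right 0)"
        by (auto intro!: tendsto_eq_intros)
      ultimately have "\<forall>\<^sub>F t in at_right 0. \<omega> r + x r + t * (y r - x r) < w r"
        by (rule order_tendstoD(2)[rotated])
      then show ?thesis by (rule eventually_mono) auto
    qed simp
  qed
  moreover have "\<forall>\<^sub>F t in at_right 0. t \<le> (1::real)"
    using eventually_at_right_less[of "0::real"] eventually_at_right[of 0 "1::real" "\<lambda>t. t \<le> 1"]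
    by (metis less_imp_le zero_less_one)
  moreover have "\<forall>\<^sub>F t in at_right 0. (0::real) < t"
    by (rule eventually_at_right_less)
  ultimately have "\<forall>\<^sub>F t in at_right 0. 0 < t \<and> t \<le> 1 \<and>
      (\<forall>r\<in>R. \<omega> r + x r < c r \<longrightarrow> \<omega> r + x r + t * (y r - x r) \<le> w r)"
    by eventually_elim auto
  from eventually_happens'[OF trivial_limit_at_right_real this]
  obtain t where t: "0 < t" "t \<le> 1"
    and step: "\<And>r. r \<in> R \<Longrightarrow> \<omega> r + x r < c r \<Longrightarrow> \<omega> r + x r + t * (y r - x r) \<le> w r"
    by blast
  \<comment> \<open>Units saturated by \<open>x\<close> at which \<open>y\<close> asks for more stay
    at \<open>x\<close>; the others move by the fraction \<open>t\<close>. Omitting those increases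
    only lowers the total, so the budget still holds.\<close>
  define z where "z r = (if \<omega> r + x r = c r \<and> x r < y r then x r else x r + t * (y r - x r))" for r
  have z_le: "z r \<le> x r + t * (y r - x r)" for r
    using t by (auto simp: z_def)
  have zb: "0 \<le> z r \<and> z r \<le> l r \<and> \<omega> r + z r \<le> c r" if r: "r \<in> R" for r
  proof -
    have "0 \<le> (1 - t) * x r + t * y r" "(1 - t) * x r + t * y r \<le> l r"
      using x(1)[OF r] y(1)[OF r] t
      by (auto intro!: convex_bound_le)
    moreover have "(1 - t) * x r + t * y r = x r + t * (y r - x r)" by (simp add: algebra_simps)
    moreover have "\<omega> r + x r \<le> c r" using w[OF r] by auto
    moreover have "t * (y r - x r) \<le> 0" if "y r \<le> x r"
      using t that by (simp add: mult_nonneg_nonpos)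
    ultimately show ?thesis
      using x(1)[OF r] step[OF r] w[OF r] unfolding z_def by (cases "\<omega> r + x r = c r"; cases "x r < y r") auto
  qed
  have "sum z R \<le> (\<Sum>r\<in>R. x r + t * (y r - x r))"
    by (intro sum_mono z_le)
  also have "\<dots> = (1 - t) * sum x R + t * sum y R"
    by (simp add: sum.distrib sum_subtractf algebra_simps flip: sum_distrib_left)
  also have "\<dots> \<le> b" using x(2) y(2) t by (intro convex_bound_le) auto
  finally have gain: "(\<Sum>r\<in>R. v r (z r) - v r (x r) - (cost (h r) (\<omega> r + z r) - cost (h r) (\<omega> r + x r))) \<le> 0"
    using opt[of z, OF zb] by (simp add: sum_subtractf)
  have "v r (y r) - v r (x r) \<le>
      (v r (z r) - v r (x r) - (cost (h r) (\<omega> r + z r) - cost (h r) (\<omega> r + x r))) / t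
      + h r (w r) * y r - (cost (h r) (\<omega> r + x r) - cost (h r) (\<omega> r))" if r: "r \<in> R" for r
    using x(1)[OF r] y(1)[OF r] w[OF r] t conc[OF r, of t] slope[OF r] step[OF r] h[OF r] \<omega>[OF r]
    by (intro unit_inequality[where c = "c r"]) (auto simp: z_def)
  then have "(\<Sum>r\<in>R. v r (y r) - v r (x r)) \<le> (\<Sum>r\<in>R.
      (v r (z r) - v r (x r) - (cost (h r) (\<omega> r + z r) - cost (h r) (\<omega> r + x r))) / t
      + h r (w r) * y r - (cost (h r) (\<omega> r + x r) - cost (h r) (\<omega> r)))"
    by (intro sum_mono)
  also have "\<dots> = (\<Sum>r\<in>R. v r (z r) - v r (x r) - (cost (h r) (\<omega> r + z r) - cost (h r) (\<omega> r + x r))) / t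
      + (\<Sum>r\<in>R. h r (w r) * y r) - (\<Sum>r\<in>R. cost (h r) (\<omega> r + x r) - cost (h r) (\<omega> r))"
    unfolding sum_divide_distrib
    by (simp only: sum.distrib[symmetric] sum_subtractf[symmetric])
  \<comment> \<open>Optimality of \<open>x\<close> makes the gain of the test allocation
    nonpositive, so its term drops out whatever the size of \<open>t\<close>.\<close>
  also have "\<dots> \<le> (\<Sum>r\<in>R. h r (w r) * y r) - (\<Sum>r\<in>R. cost (h r) (\<omega> r + x r) - cost (h r) (\<omega> r))"
    using divide_nonpos_pos[OF gain t(1)] by simp
  finally show ?thesis by (simp add: sum_subtractf)
qed


subsection \<open>A run of the online algorithm\<close>

locale online_run =
  fixes S :: "'k cluster"
    and \<alpha> \<iota> \<upsilon> :: real
    and \<theta> :: "'k runit \<Rightarrow> real"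
    and \<psi> :: "'k runit \<Rightarrow> real \<Rightarrow> real"
    and \<phi> :: "'k runit \<Rightarrow> real \<Rightarrow> ereal"
    and A :: "'k arrivals"
    and x \<omega> :: "nat \<Rightarrow> 'k runit \<Rightarrow> real"
  assumes cluster: "wf_cluster S"
    and \<alpha>: "\<alpha> \<ge> 1"
    and threshold_range: "\<And>r. r \<in> units S \<Longrightarrow> 0 \<le> \<theta> r \<and> \<theta> r \<le> capacity S r"
    and \<psi>_mono: "\<And>r. r \<in> units S \<Longrightarrow> mono_on {\<theta> r..capacity S r} (\<psi> r)"
    and \<phi>: "\<And>r. r \<in> units S \<Longrightarrow> \<phi> r = threshold_cost \<iota> (capacity S r) (\<theta> r) (\<psi> r)"
    and \<psi>_bound: "\<And>r u. r \<in> units S \<Longrightarrow> u \<in> {\<theta> r..capacity S r} \<Longrightarrow>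
           ereal (\<psi> r u * capacity S r) \<le> ereal \<alpha> * ereal_integral 0 u (\<phi> r) - ereal (\<iota> * u)"
    and \<psi>_threshold: "\<And>r. r \<in> units S \<Longrightarrow> \<psi> r (\<theta> r) = \<iota>"
    and \<psi>_capacity: "\<And>r. r \<in> units S \<Longrightarrow> \<psi> r (capacity S r) \<ge> \<upsilon>"
    and inst: "A \<in> instances S \<iota> \<upsilon>"
    and initial: "\<And>r. \<omega> 1 r = 0"
    and choice: "\<And>n. n \<in> jobs A \<Longrightarrow> P3_choice S A \<phi> (\<omega> n) n (x n)"
    and update: "\<And>n r. n \<in> jobs A \<Longrightarrow> \<omega> (Suc n) r = \<omega> n r + x n r"
begin

abbreviation "c \<equiv> capacity S"
abbreviation "h r \<equiv> price \<iota> (c r) (\<theta> r) (\<psi> r)"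
text \<open>Jobs are numbered from 1 and \<open>\<omega> n\<close> is the utilization before job
  \<open>n\<close>, hence the index \<open>Suc (num_jobs A)\<close> after the last job.\<close>

abbreviation "final \<equiv> \<omega> (Suc (num_jobs A))"

text \<open>Contribution of one unit to the welfare; its derivatives are the marginal values bounded
  by \<iota> and \<upsilon>.\<close>

definition v :: "nat \<Rightarrow> 'k runit \<Rightarrow> real \<Rightarrow> real" where
  "v n r z = utility A n r z + weight A n r * z / c r"

section \<open>Instance data and marginal values\<close>

lemma finite_units: "finite (units S)"
  using cluster by (simp add: wf_cluster_def units_def)

lemma avail_subset: "avail S A n \<subseteq> units S"
  by (auto simp: avail_def)

lemma finite_avail: "finite (avail S A n)"
  using finite_subset[OF avail_subset finite_units] .

lemma capacity_pos: "r \<in> units S \<Longrightarrow> 0 < c r"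
  using cluster by (simp add: wf_cluster_def)

lemma job_facts:
  assumes "n \<in> jobs A"
  shows "0 \<le> workload A n"
    and "r \<in> avail S A n \<Longrightarrow> 0 < limit A n r \<and> 0 \<le> weight A n r \<and> utility A n r 0 = 0 \<and>
      mono_on {0..limit A n r} (utility A n r) \<and> concave_on {0..limit A n r} (utility A n r) \<and>
      cont_diff_on {0..limit A n r} (utility A n r)"
  using inst assms by (auto simp: instances_def wf_arrivals_def)

text \<open>The minimum is attained, so \<iota> is itself a derivative of a monotone utility plus a
  nonnegative weight term.\<close>

lemma \<iota>_nonneg: "0 \<le> \<iota>"
proof -
  have "\<iota> \<in> marginal_values S A"
    using inst by (simp add: instances_def is_minimum_def)
  then obtain D n r z where *: "\<iota> = D + weight A n r / c r" "n \<in> jobs A" "r \<in> avail S A n"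
      "z \<in> {0..limit A n r}" "(utility A n r has_real_derivative D) (at z within {0..limit A n r})"
    unfolding marginal_values_def by blast
  have "0 \<le> D"
    using has_real_derivative_nonneg[OF _ _ *(4,5)] job_facts(2)[OF *(2,3)] by blast
  then show ?thesis
    using *(1) job_facts(2)[OF *(2,3)] capacity_pos[of r] avail_subset *(3) by force
qed

lemma unit_price: "r \<in> units S \<Longrightarrow> unit_price \<iota> (c r) (\<theta> r) (\<psi> r)"
  using \<iota>_nonneg threshold_range \<psi>_mono \<psi>_threshold by unfold_locales auto

lemmas h_mono = unit_price.price_mono[OF unit_price]
lemmas h_ge = unit_price.price_ge[OF unit_price]
lemmas h_below = unit_price.price_below[OF unit_price]
lemmas h_above = unit_price.price_above[OF unit_price]

lemma h_capacity: "r \<in> units S \<Longrightarrow> \<upsilon> \<le> h r (c r)"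
  using h_above[of r "c r"] threshold_range \<psi>_capacity by simp

text \<open>The mean value theorem with the extreme marginal values: \<iota> serves the tie-breaking
  argument, \<upsilon> the saturated units.\<close>

lemma v_increment:
  assumes n: "n \<in> jobs A" and r: "r \<in> avail S A n" and ab: "0 \<le> a" "a \<le> b" "b \<le> limit A n r"
  shows "\<iota> * (b - a) \<le> v n r b - v n r a" "v n r b - v n r a \<le> \<upsilon> * (b - a)"
proof -
  obtain f' where f': "\<And>z. z \<in> {0..limit A n r} \<Longrightarrow>
      (utility A n r has_real_derivative f' z) (at z within {0..limit A n r})"
    using job_facts(2)[OF n r] unfolding cont_diff_on_def by blast
  have deriv: "(v n r has_real_derivative f' z + weight A n r / c r) (at z within {0..limit A n r})"
    if "z \<in> {0..limit A n r}" for z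
    unfolding v_def by (intro DERIV_add f' that DERIV_cdivide DERIV_cmult_Id)
  have "f' z + weight A n r / c r \<in> marginal_values S A" if "z \<in> {0..limit A n r}" for z
    unfolding marginal_values_def using n r that f'[OF that] by blast
  then have "\<iota> \<le> f' z + weight A n r / c r \<and> f' z + weight A n r / c r \<le> \<upsilon>"
    if "z \<in> {0..limit A n r}" for z
    using inst that by (simp add: instances_def is_minimum_def is_maximum_def)
  from increment_bounds[OF deriv this ab]
  show "\<iota> * (b - a) \<le> v n r b - v n r a" "v n r b - v n r a \<le> \<upsilon> * (b - a)" by auto
qed

lemma v_zero: "n \<in> jobs A \<Longrightarrow> r \<in> avail S A n \<Longrightarrow> v n r 0 = 0"
  using job_facts(2) by (simp add: v_def)

lemma v_concave:
  assumes n: "n \<in> jobs A" and r: "r \<in> avail S A n" and t: "0 \<le> t" "t \<le> 1"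
    and a: "0 \<le> a" "a \<le> limit A n r" and b: "0 \<le> b" "b \<le> limit A n r"
  shows "(1 - t) * v n r a + t * v n r b \<le> v n r (a + t * (b - a))"
proof -
  have "(1 - t) * utility A n r a + t * utility A n r b \<le> utility A n r ((1 - t) * a + t * b)"
    using concave_onD[of "{0..limit A n r}" "utility A n r" t a b] job_facts(2)[OF n r] t a b by simp
  moreover have "(1 - t) * a + t * b = a + t * (b - a)" by (simp add: algebra_simps)
  ultimately show ?thesis
    by (simp add: v_def algebra_simps add_divide_distrib diff_divide_distrib)
qed

section \<open>Welfare, net values and the objective of a single job\<close>

lemma welfare_eq: "welfare S A y = (\<Sum>n\<in>jobs A. \<Sum>r\<in>avail S A n. v n r (y n r))"
  by (simp add: welfare_def job_utility_def cluster_utility_def v_def sum.distrib)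

text \<open>Real-valued form of \<open>P3_objective\<close> at utilization \<open>s\<close>; the two
  agree as long as capacity is respected.\<close>

definition net :: "('k runit \<Rightarrow> real) \<Rightarrow> nat \<Rightarrow> ('k runit \<Rightarrow> real) \<Rightarrow> real" where
  "net s n z = (\<Sum>r\<in>avail S A n. v n r (z r) - (cost (h r) (s r + z r) - cost (h r) (s r)))"

lemma P3_objective_eq:
  assumes z: "P3_feasible S A n z" and s: "\<And>r. r \<in> avail S A n \<Longrightarrow> 0 \<le> s r \<and> s r + z r \<le> c r"
  shows "P3_objective S A \<phi> s n z = ereal (net s n z)"
proof -
  have "(\<Sum>r\<in>avail S A n. ereal_integral (s r) (s r + z r) (\<phi> r)) =
      (\<Sum>r\<in>avail S A n. ereal (cost (h r) (s r + z r) - cost (h r) (s r)))"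
  proof (rule sum.cong[OF refl])
    fix r assume r: "r \<in> avail S A n"
    then have u: "r \<in> units S" using avail_subset by blast
    show "ereal_integral (s r) (s r + z r) (\<phi> r) = ereal (cost (h r) (s r + z r) - cost (h r) (s r))"
      unfolding \<phi>[OF u] using s[OF r] z r
      by (intro unit_price.ereal_integral_eq[OF unit_price[OF u]]) (auto simp: P3_feasible_def)
  qed
  then show ?thesis
    by (simp add: P3_objective_def net_def v_def job_utility_def cluster_utility_def
        sum.distrib sum_subtractf)
qed

text \<open>All cost integrals are nonnegative, so a single infinite one makes their sum
  infinite.\<close>

lemma P3_objective_overfull:
  assumes z: "P3_feasible S A n z" and s: "\<And>r. r \<in> avail S A n \<Longrightarrow> s r \<le> c r"
    and r: "r \<in> avail S A n" "c r < s r + z r"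
  shows "P3_objective S A \<phi> s n z = -\<infinity>"
proof -
  have nonneg: "0 \<le> ereal_integral (s q) (s q + z q) (\<phi> q)" if "q \<in> avail S A n" for q
  proof -
    have u: "q \<in> units S" using that avail_subset by blast
    show ?thesis
      unfolding \<phi>[OF u] by (rule unit_price.ereal_integral_nonneg[OF unit_price[OF u]])
  qed
  have u: "r \<in> units S" using r avail_subset by blast
  have "ereal_integral (s r) (s r + z r) (\<phi> r) = \<infinity>"
    unfolding \<phi>[OF u] by (rule unit_price.ereal_integral_infinite[OF unit_price[OF u] s[OF r(1)] r(2)])
  then have "(\<Sum>r\<in>avail S A n. ereal_integral (s r) (s r + z r) (\<phi> r)) = \<infinity>"
    using r(1) finite_avail nonneg by (subst sum_Pinfty) auto
  then show ?thesis by (simp add: P3_objective_def)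
qed

section \<open>Feasibility and utilization along the run\<close>

lemma x_optimal: "n \<in> jobs A \<Longrightarrow> P3_optimal S A \<phi> (\<omega> n) n (x n)"
  using choice by (simp add: P3_choice_def)

lemma x_feasible: "n \<in> jobs A \<Longrightarrow> P3_feasible S A n (x n)"
  using x_optimal by (simp add: P3_optimal_def)

lemma x_bounds: "n \<in> jobs A \<Longrightarrow> r \<in> avail S A n \<Longrightarrow> 0 \<le> x n r \<and> x n r \<le> limit A n r"
  using x_feasible by (simp add: P3_feasible_def)

lemma x_outside: "n \<in> jobs A \<Longrightarrow> r \<notin> avail S A n \<Longrightarrow> x n r = 0"
  using x_feasible unfolding P3_feasible_def by blast

lemma x_nonneg: "n \<in> jobs A \<Longrightarrow> 0 \<le> x n r"
  using x_bounds x_outside by (cases "r \<in> avail S A n") auto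

text \<open>An overfull unit would make the objective \<open>-\<infinity>\<close>, while the null allocation has value \<open>0\<close>.\<close>
lemma step_within_capacity:
  assumes n: "n \<in> jobs A" and \<omega>: "\<And>r. r \<in> units S \<Longrightarrow> 0 \<le> \<omega> n r \<and> \<omega> n r \<le> c r"
    and r: "r \<in> units S"
  shows "\<omega> n r + x n r \<le> c r"
proof (cases "r \<in> avail S A n")
  case True
  show ?thesis
  proof (rule ccontr)
    assume "\<not> ?thesis"
    then have "P3_objective S A \<phi> (\<omega> n) n (x n) = -\<infinity>"
      using \<omega> avail_subset by (intro P3_objective_overfull[OF x_feasible[OF n] _ True]) auto
    moreover have feasible: "P3_feasible S A n (\<lambda>_. 0)"
      using job_facts[OF n] by (force simp: P3_feasible_def)
    moreover have "P3_objective S A \<phi> (\<omega> n) n (\<lambda>_. 0) = ereal (net (\<omega> n) n (\<lambda>_. 0))"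
      by (rule P3_objective_eq[OF feasible]) (use \<omega> avail_subset in auto)
    ultimately show False
      using x_optimal[OF n] by (auto simp: P3_optimal_def)
  qed
next
  case False
  then show ?thesis using \<omega>[OF r] x_outside[OF n] by simp
qed

text \<open>Induction along the run, with \<open>r\<close> arbitrary because
  \<open>step_within_capacity\<close> needs the bounds on all units at once.\<close>

lemma \<omega>_bounds:
  assumes "1 \<le> n" "n \<le> Suc (num_jobs A)"
  shows "r \<in> units S \<Longrightarrow> 0 \<le> \<omega> n r \<and> \<omega> n r \<le> c r"
  using assms
proof (induction n arbitrary: r rule: dec_induct)
  case base
  then show ?case using initial capacity_pos[of r] by simp
next
  case (step n)
  then have n: "n \<in> jobs A" by (simp add: jobs_def)
  have IH: "0 \<le> \<omega> n q \<and> \<omega> n q \<le> c q" if "q \<in> units S" for q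
    using step.IH[OF that] step.prems by simp
  show ?case
    using step_within_capacity[OF n IH step.prems(1)] IH[OF step.prems(1)] x_nonneg[OF n, of r] update[OF n, of r]
    by simp
qed

lemma \<omega>_job_bounds:
  assumes "n \<in> jobs A" "r \<in> units S"
  shows "0 \<le> \<omega> n r" "\<omega> n r + x n r \<le> c r"
  using \<omega>_bounds[of n r] \<omega>_bounds[of "Suc n" r] update[OF assms(1), of r] assms by (auto simp: jobs_def)

lemma \<omega>_eq: "n \<le> num_jobs A \<Longrightarrow> \<omega> (Suc n) r = (\<Sum>m\<in>{1..n}. x m r)"
proof (induction n)
  case 0
  then show ?case using initial by simp
next
  case (Suc n)
  then show ?case using update[of "Suc n" r] by (simp add: jobs_def)
qed

lemma final_eq: "final r = (\<Sum>n\<in>jobs A. x n r)"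
  using \<omega>_eq[of "num_jobs A"] by (simp add: jobs_def)

lemma \<omega>_le_final:
  assumes "n \<in> jobs A"
  shows "\<omega> n r + x n r \<le> final r"
proof -
  have "\<omega> n r + x n r = (\<Sum>m\<in>{1..n}. x m r)"
    using \<omega>_eq[of n r] update[OF assms, of r] assms by (simp add: jobs_def)
  also have "\<dots> \<le> final r"
    unfolding final_eq using assms x_nonneg by (intro sum_mono2) (auto simp: jobs_def)
  finally show ?thesis .
qed

text \<open>Successive jobs pay the integrals over adjacent intervals, starting from utilization
  0.\<close>

lemma cost_telescope:
  "(\<Sum>n\<in>jobs A. cost (h r) (\<omega> n r + x n r) - cost (h r) (\<omega> n r)) = cost (h r) (final r)"
proof -
  have "(\<Sum>n\<in>jobs A. cost (h r) (\<omega> n r + x n r) - cost (h r) (\<omega> n r)) =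
      (\<Sum>n\<in>jobs A. cost (h r) (\<omega> (Suc n) r) - cost (h r) (\<omega> n r))"
    by (intro sum.cong) (simp_all add: update)
  also have "\<dots> = cost (h r) (final r) - cost (h r) (\<omega> 1 r)"
    unfolding jobs_def by (subst sum_Suc_diff) auto
  also have "cost (h r) (\<omega> 1 r) = 0"
    by (simp add: initial[unfolded One_nat_def] cost_def)
  finally show ?thesis by simp
qed

section \<open>Consequences of optimality and tie-breaking\<close>

lemma x_max:
  assumes n: "n \<in> jobs A" and z: "P3_feasible S A n z"
    and cap: "\<And>r. r \<in> avail S A n \<Longrightarrow> \<omega> n r + z r \<le> c r"
  shows "net (\<omega> n) n z \<le> net (\<omega> n) n (x n)"
proof -
  have u: "r \<in> avail S A n \<Longrightarrow> r \<in> units S" for r using avail_subset by blast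
  have "P3_objective S A \<phi> (\<omega> n) n z = ereal (net (\<omega> n) n z)"
    using z cap \<omega>_job_bounds[OF n u] by (intro P3_objective_eq) auto
  moreover have "P3_objective S A \<phi> (\<omega> n) n (x n) = ereal (net (\<omega> n) n (x n))"
    using x_feasible[OF n] \<omega>_job_bounds[OF n u] by (intro P3_objective_eq) auto
  ultimately show ?thesis
    using x_optimal[OF n] z by (metis P3_optimal_def ereal_less_eq(3))
qed

text \<open>
  Below the threshold the price is \<open>\<iota>\<close>, at most any marginal value, so enlarging the allocation
  there preserves optimality, which the tie-breaking rule excludes.
\<close>
lemma saturated_below_threshold:
  assumes n: "n \<in> jobs A" and r: "r \<in> avail S A n" and below: "final r < \<theta> r"
    and loose: "(\<Sum>r\<in>avail S A n. x n r) < workload A n"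
  shows "x n r = limit A n r"
proof (rule ccontr)
  assume "x n r \<noteq> limit A n r"
  with x_bounds[OF n r] have lim: "x n r < limit A n r" by simp
  have u: "r \<in> units S" using r avail_subset by blast
  have units: "q \<in> avail S A n \<Longrightarrow> q \<in> units S" for q using avail_subset by blast
  \<comment> \<open>The increase is limited by three slacks: budget, job limit and distance to the
    threshold.\<close>
  define e where "e = min (workload A n - (\<Sum>r\<in>avail S A n. x n r)) (min (limit A n r - x n r) (\<theta> r - (\<omega> n r + x n r)))"
  have e: "0 < e" "(\<Sum>r\<in>avail S A n. x n r) + e \<le> workload A n" "x n r + e \<le> limit A n r"
      "\<omega> n r + x n r + e \<le> \<theta> r"
    using lim loose below \<omega>_le_final[OF n, of r] unfolding e_def by auto
  define y where "y = (x n)(r := x n r + e)"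
  have "(\<Sum>q\<in>avail S A n. y q) = (\<Sum>q\<in>avail S A n. x n q) + e"
    using r finite_avail by (simp add: y_def sum.remove[OF finite_avail r])
  then have y: "P3_feasible S A n y"
    using x_bounds[OF n] x_outside[OF n] e r by (auto simp: P3_feasible_def y_def)
  have cap: "\<omega> n q + y q \<le> c q" if "q \<in> avail S A n" for q
    using \<omega>_job_bounds(2)[OF n units[OF that]] e(4) threshold_range[OF u] by (auto simp: y_def)
  have \<omega>r: "0 \<le> \<omega> n r" "0 \<le> x n r" using \<omega>_job_bounds[OF n u] x_bounds[OF n r] by auto
  have "net (\<omega> n) n y - net (\<omega> n) n (x n) =
      v n r (x n r + e) - v n r (x n r) - (cost (h r) (\<omega> n r + x n r + e) - cost (h r) (\<omega> n r + x n r))"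
    unfolding net_def by (simp add: sum.remove[OF finite_avail r] y_def add.assoc)
  also have "cost (h r) (\<omega> n r + x n r + e) - cost (h r) (\<omega> n r + x n r) = \<iota> * e"
    using unit_price.cost_below[OF unit_price[OF u], of "\<omega> n r + x n r + e"]
      unit_price.cost_below[OF unit_price[OF u], of "\<omega> n r + x n r"] \<omega>r e
    by (simp add: algebra_simps)
  finally have "net (\<omega> n) n (x n) \<le> net (\<omega> n) n y"
    using v_increment(1)[OF n r, of "x n r" "x n r + e"] \<omega>r e by simp
  moreover have "P3_objective S A \<phi> (\<omega> n) n y = ereal (net (\<omega> n) n y)"
    using y cap \<omega>_job_bounds[OF n units] by (intro P3_objective_eq) auto
  moreover have "P3_objective S A \<phi> (\<omega> n) n (x n) = ereal (net (\<omega> n) n (x n))"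
    using x_feasible[OF n] \<omega>_job_bounds[OF n units] by (intro P3_objective_eq) auto
  ultimately have "P3_optimal S A \<phi> (\<omega> n) n y"
    using x_optimal[OF n] y unfolding P3_optimal_def by (metis ereal_less_eq(3) order_trans)
  moreover have "\<forall>q. x n q \<le> y q" using e by (simp add: y_def)
  ultimately have "y = x n" using choice[OF n] unfolding P3_choice_def by blast
  then have "y r = x n r" by simp
  then show False using e(1) by (simp add: y_def)
qed

text \<open>Utilization only grows along the run, so reference points at or beyond the final
  utilization serve every job; the prices become common to all jobs.\<close>

lemma job_bound:
  assumes n: "n \<in> jobs A" and y: "P1_feasible S A y"
    and w: "\<And>r. r \<in> units S \<Longrightarrow> final r \<le> w r \<and> w r \<le> c r \<and> (final r = w r \<longrightarrow> w r = c r)"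
  shows "(\<Sum>r\<in>avail S A n. v n r (y n r)) \<le> net (\<omega> n) n (x n) + (\<Sum>r\<in>avail S A n. h r (w r) * y n r)"
  unfolding net_def
proof (rule job_inequality[where l = "limit A n" and c = c and b = "workload A n"])
  show "finite (avail S A n)" by (rule finite_avail)
  show "sum (x n) (avail S A n) \<le> workload A n" using x_feasible[OF n] by (simp add: P3_feasible_def)
  show "sum (y n) (avail S A n) \<le> workload A n" using y n by (simp add: P1_feasible_def)
  fix r assume r: "r \<in> avail S A n"
  then have u: "r \<in> units S" using avail_subset by blast
  show "mono (h r)" by (rule h_mono[OF u])
  show "0 \<le> \<omega> n r" by (rule \<omega>_job_bounds(1)[OF n u])
  show xb: "0 \<le> x n r \<and> x n r \<le> limit A n r" by (rule x_bounds[OF n r])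
  show yb: "0 \<le> y n r \<and> y n r \<le> limit A n r" using y n r by (simp add: P1_feasible_def)
  show "(1 - t) * v n r (x n r) + t * v n r (y n r) \<le> v n r (x n r + t * (y n r - x n r))"
    if "0 \<le> t" "t \<le> 1" for t
    using v_concave[OF n r that] xb yb by blast
  show "v n r (y n r) - v n r (x n r) \<le> h r (c r) * (y n r - x n r)" if "x n r \<le> y n r"
  proof -
    have "v n r (y n r) - v n r (x n r) \<le> \<upsilon> * (y n r - x n r)"
      using v_increment(2)[OF n r] xb yb that by blast
    also have "\<dots> \<le> h r (c r) * (y n r - x n r)"
      using h_capacity[OF u] that by (intro mult_right_mono) auto
    finally show ?thesis .
  qed
  \<comment> \<open>Since \<open>final r\<close> lies between both sides, equality forces
    \<open>final r = w r\<close>, hence capacity.\<close>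
  show "\<omega> n r + x n r \<le> w r \<and> w r \<le> c r \<and> (\<omega> n r + x n r = w r \<longrightarrow> w r = c r)"
    using w[OF u] \<omega>_le_final[OF n, of r] by auto
next
  fix z assume z: "\<And>r. r \<in> avail S A n \<Longrightarrow> 0 \<le> z r \<and> z r \<le> limit A n r \<and> \<omega> n r + z r \<le> c r"
    "sum z (avail S A n) \<le> workload A n"
  \<comment> \<open>\<open>job_inequality\<close> leaves \<open>z\<close> free outside
    \<open>avail S A n\<close>, where feasibility demands 0.\<close>
  let ?z = "\<lambda>r. if r \<in> avail S A n then z r else 0"
  have "P3_feasible S A n ?z" using z by (simp add: P3_feasible_def cong: sum.cong)
  from x_max[OF n this] z
  show "(\<Sum>r\<in>avail S A n. v n r (z r) - (cost (h r) (\<omega> n r + z r) - cost (h r) (\<omega> n r))) \<le>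
      (\<Sum>r\<in>avail S A n. v n r (x n r) - (cost (h r) (\<omega> n r + x n r) - cost (h r) (\<omega> n r)))"
    by (simp add: net_def cong: sum.cong)
qed

section \<open>Prices at the final utilization\<close>

lemma capacity_price_bound:
  assumes r: "r \<in> units S" and u: "\<theta> r \<le> u" "u \<le> c r"
  shows "h r u * c r \<le> \<alpha> * cost (h r) u - \<iota> * u"
proof -
  have "ereal_integral 0 u (\<phi> r) = ereal (cost (h r) u)"
    using unit_price.ereal_integral_eq[OF unit_price[OF r], of 0 u] u threshold_range[OF r] \<phi>[OF r]
    by (simp add: cost_def)
  then show ?thesis using \<psi>_bound[OF r, of u] u h_above[OF r u] by simp
qed

text \<open>
  Prices are read slightly beyond the final utilization because \<open>\<psi> r\<close> may jump there;
  \<open>\<eta>\<close> absorbs the difference.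
\<close>
lemma reference_utilization:
  assumes r: "r \<in> units S" and \<eta>: "0 < \<eta>"
  shows "\<exists>w. final r \<le> w \<and> w \<le> c r \<and> (final r = w \<longrightarrow> w = c r) \<and>
    (final r < \<theta> r \<longrightarrow> h r w = \<iota>) \<and>
    (\<theta> r \<le> final r \<longrightarrow> h r w * c r \<le> \<alpha> * cost (h r) (final r) - \<iota> * final r + \<eta>)"
proof -
  have fin: "0 \<le> final r" "final r \<le> c r" using \<omega>_bounds[of "Suc (num_jobs A)" r] r by auto
  consider "final r < \<theta> r" | "\<theta> r \<le> final r" "final r = c r" | "\<theta> r \<le> final r" "final r < c r"
    using fin by fastforce
  then show ?thesis
  proof cases
    case 1
    then show ?thesis
      using threshold_range[OF r] h_below[OF r, of "\<theta> r"] by (intro exI[of _ "\<theta> r"]) auto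
  next
    case 2
    then show ?thesis
      using capacity_price_bound[OF r, of "c r"] \<eta> by (intro exI[of _ "c r"]) auto
  next
    case 3
    \<comment> \<open>The cost added between \<open>final r\<close> and \<open>w\<close>, scaled by
      \<alpha>, is at most \<open>K * (w - final r)\<close>, whence the distance
      \<open>\<eta> / K\<close>; the \<open>+ 1\<close> keeps \<open>K\<close> positive even at
      price 0.\<close>
    define K where "K = \<alpha> * h r (c r) + 1"
    have K: "0 < K" using \<alpha> h_ge[OF r, of "c r"] \<iota>_nonneg by (simp add: K_def add_nonneg_pos)
    define w where "w = min (c r) (final r + \<eta> / K)"
    have w: "final r < w" "w \<le> c r" "w - final r \<le> \<eta> / K"
      using 3 \<eta> K by (auto simp: w_def)
    have "cost (h r) w - cost (h r) (final r) \<le> h r w * (w - final r)"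
      using cost_bounds(2)[OF h_mono[OF r] fin(1)] w by simp
    also have "\<dots> \<le> h r (c r) * (w - final r)"
      using w monoD[OF h_mono[OF r] w(2)] by (intro mult_right_mono) auto
    finally have "\<alpha> * (cost (h r) w - cost (h r) (final r)) \<le> \<alpha> * (h r (c r) * (w - final r))"
      using \<alpha> by (intro mult_left_mono) auto
    also have "\<dots> \<le> K * (w - final r)" using w by (simp add: K_def algebra_simps)
    also have "\<dots> \<le> \<eta>" using w K by (simp add: field_simps)
    finally have "\<alpha> * (cost (h r) w - cost (h r) (final r)) \<le> \<eta>" .
    moreover have "\<iota> * final r \<le> \<iota> * w" using w \<iota>_nonneg by (intro mult_left_mono) auto
    moreover have "h r w * c r \<le> \<alpha> * cost (h r) w - \<iota> * w"
      using capacity_price_bound[OF r, of w] 3 w by simp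
    ultimately have "h r w * c r \<le> \<alpha> * cost (h r) (final r) - \<iota> * final r + \<eta>"
      by (simp add: algebra_simps)
    then show ?thesis using w 3 by (intro exI[of _ w]) auto
  qed
qed

text \<open>The null allocation is feasible and has net value 0.\<close>

lemma net_nonneg:
  assumes n: "n \<in> jobs A"
  shows "0 \<le> net (\<omega> n) n (x n)"
proof -
  have "P3_feasible S A n (\<lambda>_. 0)"
    using job_facts[OF n] by (force simp: P3_feasible_def)
  moreover have "\<omega> n r + 0 \<le> c r" if "r \<in> avail S A n" for r
    using \<omega>_job_bounds[OF n, of r] x_nonneg[OF n, of r] that avail_subset by force
  ultimately have "net (\<omega> n) n (\<lambda>_. 0) \<le> net (\<omega> n) n (x n)" by (rule x_max[OF n])
  then show ?thesis using v_zero[OF n] by (simp add: net_def)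
qed

section \<open>Summation over jobs and units\<close>

lemma sum_avail:
  assumes "\<And>r. r \<in> units S \<Longrightarrow> r \<notin> avail S A n \<Longrightarrow> f r = 0"
  shows "sum f (avail S A n) = sum f (units S)"
  using assms by (intro sum.mono_neutral_left finite_units avail_subset) auto

text \<open>Units outside \<open>avail S A n\<close> receive nothing and incur no cost, so the cost
  sums may run over all units; swapping them lets the costs telescope.\<close>

lemma sum_net: "(\<Sum>n\<in>jobs A. net (\<omega> n) n (x n)) = welfare S A x - (\<Sum>r\<in>units S. cost (h r) (final r))"
proof -
  have "net (\<omega> n) n (x n) = (\<Sum>r\<in>avail S A n. v n r (x n r))
      - (\<Sum>r\<in>units S. cost (h r) (\<omega> n r + x n r) - cost (h r) (\<omega> n r))" if "n \<in> jobs A" for n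
    unfolding net_def sum_subtractf[of "\<lambda>r. v n r (x n r)"]
    using x_outside[OF that] by (subst sum_avail[symmetric]) auto
  then have "(\<Sum>n\<in>jobs A. net (\<omega> n) n (x n)) = welfare S A x
      - (\<Sum>n\<in>jobs A. \<Sum>r\<in>units S. cost (h r) (\<omega> n r + x n r) - cost (h r) (\<omega> n r))"
    by (simp add: welfare_eq sum_subtractf)
  also have "(\<Sum>n\<in>jobs A. \<Sum>r\<in>units S. cost (h r) (\<omega> n r + x n r) - cost (h r) (\<omega> n r)) =
      (\<Sum>r\<in>units S. cost (h r) (final r))"
    by (subst sum.swap) (simp only: cost_telescope)
  finally show ?thesis .
qed

text \<open>
  A job with slack budget takes its limit on the units below threshold; one with exhausted budget
  allocates at least as much in total as any competitor.
\<close>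
lemma allocation_bound:
  assumes n: "n \<in> jobs A" and y: "P1_feasible S A y"
  shows "(\<Sum>r\<in>units S. y n r) \<le> (\<Sum>r\<in>units S. x n r) + (\<Sum>r\<in>{r\<in>units S. \<theta> r \<le> final r}. y n r)"
proof -
  have out: "y n r = 0" if "r \<in> units S" "r \<notin> avail S A n" for r
    using y n that by (simp add: P1_feasible_def)
  have y0: "0 \<le> y n r" if "r \<in> units S" for r
    using y n that out[OF that] by (cases "r \<in> avail S A n") (auto simp: P1_feasible_def)
  show ?thesis
  proof (cases "(\<Sum>r\<in>avail S A n. x n r) < workload A n")
    case True
    let ?H = "{r\<in>units S. \<theta> r \<le> final r}"
    have "(\<Sum>r\<in>units S. y n r) = (\<Sum>r\<in>units S - ?H. y n r) + (\<Sum>r\<in>?H. y n r)"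
      using finite_units by (intro sum.subset_diff) auto
    moreover have "(\<Sum>r\<in>units S - ?H. y n r) \<le> (\<Sum>r\<in>units S - ?H. x n r)"
    proof (rule sum_mono)
      fix r assume r: "r \<in> units S - ?H"
      show "y n r \<le> x n r"
      proof (cases "r \<in> avail S A n")
        case a: True
        then show ?thesis
          using saturated_below_threshold[OF n a _ True] r y n by (auto simp: P1_feasible_def)
      qed (use r out x_nonneg[OF n] in auto)
    qed
    moreover have "(\<Sum>r\<in>units S - ?H. x n r) \<le> (\<Sum>r\<in>units S. x n r)"
      using finite_units x_nonneg[OF n] by (intro sum_mono2) auto
    ultimately show ?thesis by simp
  next
    case False
    have "(\<Sum>r\<in>units S. y n r) = (\<Sum>r\<in>avail S A n. y n r)"
      by (rule sum_avail[symmetric]) (use out in auto)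
    also have "\<dots> \<le> workload A n" using y n by (simp add: P1_feasible_def)
    also have "\<dots> \<le> (\<Sum>r\<in>avail S A n. x n r)" using False by simp
    also have "\<dots> = (\<Sum>r\<in>units S. x n r)"
      by (rule sum_avail) (use x_outside[OF n] in auto)
    finally show ?thesis
      using sum_nonneg[of "{r\<in>units S. \<theta> r \<le> final r}" "y n"] y0 by force
  qed
qed

lemma welfare_bound:
  assumes y: "P1_feasible S A y"
  shows "welfare S A y \<le> \<alpha> * welfare S A x"
proof (rule field_le_epsilon)
  fix e :: real assume e: "0 < e"
  \<comment> \<open>The error \<open>e\<close> for reading prices beyond the final utilization is
    shared among the units; the \<open>+ 1\<close> covers a cluster without units.\<close>
  define \<eta> where "\<eta> = e / (real (card (units S)) + 1)"
  have \<eta>: "0 < \<eta>" "real (card (units S)) * \<eta> \<le> e"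
    using e by (auto simp: \<eta>_def field_simps add_pos_nonneg)
  obtain w where w: "\<And>r. r \<in> units S \<Longrightarrow> final r \<le> w r \<and> w r \<le> c r \<and> (final r = w r \<longrightarrow> w r = c r) \<and>
      (final r < \<theta> r \<longrightarrow> h r (w r) = \<iota>) \<and>
      (\<theta> r \<le> final r \<longrightarrow> h r (w r) * c r \<le> \<alpha> * cost (h r) (final r) - \<iota> * final r + \<eta>)"
    using reference_utilization[OF _ \<eta>(1)] by metis
  let ?H = "{r\<in>units S. \<theta> r \<le> final r}" and ?L = "{r\<in>units S. final r < \<theta> r}"
  have split: "sum f (units S) = sum f ?L + sum f ?H" for f :: "'k runit \<Rightarrow> real"
  proof -
    have "units S - ?H = ?L" by auto
    then show ?thesis
      using sum.subset_diff[of ?H "units S" f] finite_units by simp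
  qed
  define Y where "Y r = (\<Sum>n\<in>jobs A. y n r)" for r
  have Y: "Y r \<le> c r" if "r \<in> units S" for r
    using y that by (simp add: P1_feasible_def Y_def)
  have out: "y n r = 0" if "n \<in> jobs A" "r \<in> units S" "r \<notin> avail S A n" for n r
    using y that by (simp add: P1_feasible_def)
  have "welfare S A y \<le> (\<Sum>n\<in>jobs A. net (\<omega> n) n (x n) + (\<Sum>r\<in>avail S A n. h r (w r) * y n r))"
    unfolding welfare_eq using w by (intro sum_mono job_bound y) auto
  also have "\<dots> = (\<Sum>n\<in>jobs A. net (\<omega> n) n (x n)) + (\<Sum>n\<in>jobs A. \<Sum>r\<in>units S. h r (w r) * y n r)"
    unfolding sum.distrib using out by (intro arg_cong2[where f = "(+)"] sum.cong sum_avail) auto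
  also have "(\<Sum>n\<in>jobs A. \<Sum>r\<in>units S. h r (w r) * y n r) = (\<Sum>r\<in>units S. h r (w r) * Y r)"
    by (subst sum.swap) (simp add: Y_def sum_distrib_left)
  finally have 1: "welfare S A y \<le> welfare S A x - (\<Sum>r\<in>units S. cost (h r) (final r)) + (\<Sum>r\<in>units S. h r (w r) * Y r)"
    by (simp add: sum_net)
  have "(\<Sum>n\<in>jobs A. \<Sum>r\<in>units S. y n r) \<le>
      (\<Sum>n\<in>jobs A. (\<Sum>r\<in>units S. x n r) + (\<Sum>r\<in>?H. y n r))"
    by (intro sum_mono allocation_bound y)
  also have "\<dots> = (\<Sum>r\<in>units S. final r) + sum Y ?H"
    unfolding sum.distrib Y_def final_eq by (simp only: sum.swap[of _ _ "jobs A"])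
  also have "(\<Sum>n\<in>jobs A. \<Sum>r\<in>units S. y n r) = sum Y (units S)"
    unfolding Y_def by (rule sum.swap)
  finally have "sum Y (units S) \<le> sum final (units S) + sum Y ?H" .
  \<comment> \<open>What \<open>y\<close> places at or above threshold cancels: only its amount
    below threshold is charged to the online total.\<close>
  then have L: "sum Y ?L \<le> sum final (units S)" by (simp add: split)
  have "(\<Sum>r\<in>units S. h r (w r) * Y r) = \<iota> * sum Y ?L + (\<Sum>r\<in>?H. h r (w r) * Y r)"
    unfolding split using w by (simp add: sum_distrib_left)
  \<comment> \<open>On \<open>?L\<close> the online total pays at price \<iota>; on
    \<open>?H\<close> the amount \<open>Y r\<close> is raised to the full capacity, where the bound
    on \<open>w r\<close> applies.\<close>
  also have "\<dots> \<le> \<iota> * sum final (units S) + (\<Sum>r\<in>?H. \<alpha> * cost (h r) (final r) - \<iota> * final r + \<eta>)"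
  proof (intro add_mono mult_left_mono L \<iota>_nonneg sum_mono)
    fix r assume r: "r \<in> ?H"
    then have "h r (w r) * Y r \<le> h r (w r) * c r"
      using Y[of r] h_ge[of r "w r"] \<iota>_nonneg by (intro mult_left_mono) auto
    then show "h r (w r) * Y r \<le> \<alpha> * cost (h r) (final r) - \<iota> * final r + \<eta>"
      using w[of r] r by auto
  qed
  \<comment> \<open>The charges \<open>\<iota> * final r\<close> on \<open>?H\<close> cancel against
    the terms \<open>- \<iota> * final r\<close>.\<close>
  also have "\<dots> = (\<Sum>r\<in>?L. \<iota> * final r) + (\<Sum>r\<in>?H. \<alpha> * cost (h r) (final r)) + real (card ?H) * \<eta>"
    unfolding split[of final] by (simp add: sum.distrib sum_subtractf sum_distrib_left algebra_simps)
  also have "\<dots> \<le> (\<Sum>r\<in>?L. \<alpha> * cost (h r) (final r)) + (\<Sum>r\<in>?H. \<alpha> * cost (h r) (final r)) + e"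
  proof (intro add_mono order_refl sum_mono)
    fix r assume r: "r \<in> ?L"
    then have "0 \<le> final r" using \<omega>_bounds[of "Suc (num_jobs A)" r] by auto
    then have "cost (h r) (final r) = \<iota> * final r" "0 \<le> \<iota> * final r"
      using unit_price.cost_below[OF unit_price, of r "final r"] r \<iota>_nonneg by auto
    then show "\<iota> * final r \<le> \<alpha> * cost (h r) (final r)"
      using mult_right_mono[OF \<alpha>, of "\<iota> * final r"] by simp
  next
    have "card ?H \<le> card (units S)" using finite_units by (intro card_mono) auto
    then have "real (card ?H) * \<eta> \<le> real (card (units S)) * \<eta>" using \<eta> by (intro mult_right_mono) auto
    then show "real (card ?H) * \<eta> \<le> e" using \<eta>(2) by linarith
  qed
  also have "\<dots> = \<alpha> * (\<Sum>r\<in>units S. cost (h r) (final r)) + e"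
    unfolding split by (simp add: sum_distrib_left algebra_simps)
  finally have 2: "(\<Sum>r\<in>units S. h r (w r) * Y r) \<le> \<alpha> * (\<Sum>r\<in>units S. cost (h r) (final r)) + e" .
  \<comment> \<open>Nonnegative net values bound the total cost by the online welfare, which
    replaces the remaining \<open>\<alpha> - 1\<close> times the cost.\<close>
  have "0 \<le> (\<Sum>n\<in>jobs A. net (\<omega> n) n (x n))" by (intro sum_nonneg net_nonneg)
  then have "(\<Sum>r\<in>units S. cost (h r) (final r)) \<le> welfare S A x" by (simp add: sum_net)
  then have "(\<alpha> - 1) * (\<Sum>r\<in>units S. cost (h r) (final r)) \<le> (\<alpha> - 1) * welfare S A x"
    using \<alpha> by (intro mult_left_mono) auto
  with 1 2 show "welfare S A y \<le> \<alpha> * welfare S A x + e" by (simp add: algebra_simps)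
qed

text \<open>The null allocation makes the optimum nonnegative, so zero online welfare forces optimum
  0 and the ratio is \<open>0 / 0 = 0\<close>; otherwise \<open>welfare_bound\<close> is divided by
  the positive welfare.\<close>

lemma ratio_bound: "P1_value S A / ereal (welfare S A x) \<le> ereal \<alpha>"
proof -
  have W: "0 \<le> welfare S A x"
  proof -
    have "0 \<le> v n r (x n r)" if "n \<in> jobs A" "r \<in> avail S A n" for n r
    proof -
      have "\<iota> * x n r \<le> v n r (x n r)"
        using v_increment(1)[OF that, of 0 "x n r"] x_bounds[OF that] v_zero[OF that] by simp
      moreover have "0 \<le> \<iota> * x n r" using \<iota>_nonneg x_bounds[OF that] by simp
      ultimately show ?thesis by linarith
    qed
    then show ?thesis unfolding welfare_eq by (intro sum_nonneg) auto
  qed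
  have upper: "P1_value S A \<le> ereal (\<alpha> * welfare S A x)"
    unfolding P1_value_def using welfare_bound by (intro SUP_least) auto
  have "P1_feasible S A (\<lambda>_ _. 0)"
    using job_facts capacity_pos by (force simp: P1_feasible_def)
  then have "ereal (welfare S A (\<lambda>_ _. 0)) \<le> P1_value S A"
    unfolding P1_value_def by (intro SUP_upper) auto
  then have lower: "0 \<le> P1_value S A"
    using v_zero by (simp add: welfare_eq zero_ereal_def)
  show ?thesis
  proof (cases "welfare S A x = 0")
    case True
    then have "P1_value S A = 0" using upper lower by (simp add: zero_ereal_def)
    then show ?thesis using \<alpha> by simp
  next
    case False
    then show ?thesis
      using upper W by (subst ereal_divide_le_pos) (auto simp: mult.commute)
  qed
qed

end

theorem theorem1:
  fixes S :: "'k cluster"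
    and \<alpha> \<iota> \<upsilon> :: real
    and \<theta> :: "'k runit \<Rightarrow> real"
    and \<psi> :: "'k runit \<Rightarrow> real \<Rightarrow> real"
    and \<phi> :: "'k runit \<Rightarrow> real \<Rightarrow> ereal"
  assumes "wf_cluster S"
    and "\<alpha> \<ge> 1"
    and "\<And>r. r \<in> units S \<Longrightarrow> 0 \<le> \<theta> r \<and> \<theta> r \<le> capacity S r"
    and "\<And>r. r \<in> units S \<Longrightarrow> mono_on {\<theta> r..capacity S r} (\<psi> r)"
    and "\<And>r. r \<in> units S \<Longrightarrow> \<phi> r = threshold_cost \<iota> (capacity S r) (\<theta> r) (\<psi> r)"
    and "\<And>r \<omega>. r \<in> units S \<Longrightarrow> \<omega> \<in> {\<theta> r..capacity S r} \<Longrightarrow>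
           ereal (\<psi> r \<omega> * capacity S r) \<le> ereal \<alpha> * ereal_integral 0 \<omega> (\<phi> r) - ereal (\<iota> * \<omega>)"
    and "\<And>r. r \<in> units S \<Longrightarrow> \<psi> r (\<theta> r) = \<iota>"
    and "\<And>r. r \<in> units S \<Longrightarrow> \<psi> r (capacity S r) \<ge> \<upsilon>"
  shows "competitive S \<iota> \<upsilon> \<alpha> (OnSocMax S \<phi>)"
  unfolding competitive_def competitive_ratio_def
proof (intro SUP_least, clarify)
  fix A :: "'k arrivals" and x
  assume A: "A \<in> instances S \<iota> \<upsilon>" and "OnSocMax S \<phi> A x"
  then obtain \<omega> where \<omega>: "\<And>r. \<omega> 1 r = 0"
      "\<And>n. n \<in> jobs A \<Longrightarrow> P3_choice S A \<phi> (\<omega> n) n (x n) \<and> (\<forall>r. \<omega> (n + 1) r = \<omega> n r + x n r)"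
    unfolding OnSocMax_def by metis
  interpret online_run S \<alpha> \<iota> \<upsilon> \<theta> \<psi> \<phi> A x \<omega>
    by unfold_locales (use assms A \<omega> in auto)
  show "P1_value S A / ereal (welfare S A x) \<le> ereal \<alpha>"
    by (rule ratio_bound)
qed

end
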